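(* If $\Phi=\{\phi_j\}_{j=1}^5$ is a tight Grassmannian frame consisting of $5$ unit vectors in $\mathbb C^2$ (that is, $\Phi\in\Omega_{5,2}(\mathbb C)$ is tight and $\mu(\Phi)=\mu_{5,2}(\mathbb C)$), then its angle set satisfies $|A_\Phi|\ge 3$.
   Context: A frame for $\mathbb F^M$ ($\mathbb F=\mathbb R$ or $\mathbb C$) is an indexed finite family $\Phi=\{\phi_j\}_{j=1}^N\subset\mathbb F^M$ whose span is $\mathbb F^M$. It is unit-norm if $\|\phi_j\|=1$ for all $j$, and tight if there is $A>0$ with $\sum_{j=1}^N\phi_j\phi_j^*=A\,I_M$, where $I_M$ is the $M\times M$ identity matrix. $\Omega_{N,M}(\mathbb F)$ denotes the set of unit-norm frames consisting of $N$ vectors in $\mathbb F^M$. For $\Phi\in\Omega_{N,M}(\mathbb F)$, its angle set is $A_\Phi=\{|\langle\phi_j,\phi_l\rangle| : j\ne l\}$ and its coherence is $\mu(\Phi)=\max_{j\neq l}|\langle\phi_j,\phi_l\rangle|$. The Grassmannian constant is $\mu_{N,M}(\mathbb F)=\inf_{\Psi\in\Omega_{N,M}(\mathbb F)}\mu(\Psi)$, and $\Phi\in\Omega_{N,M}(\mathbb F)$ is a Grassmannian frame if $\mu(\Phi)=\mu_{N,M}(\mathbb F)$. *)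

theory Defs
  imports "HOL-Analysis.Analysis"
begin

text \<open>
  The inner product \<open>\<bullet>\<close> of the library on \<open>complex ^ 'm\<close> is the real one (the real part of the
  Hermitian product), so the Hermitian product is introduced here.  It is linear in the first
  argument.  The library norm on \<open>complex ^ 'm\<close> is the norm it induces (\<open>hinner_self\<close> below).
\<close>

definition hinner :: "complex ^ 'm \<Rightarrow> complex ^ 'm \<Rightarrow> complex" where
  "hinner x y = (\<Sum>i\<in>UNIV. x $ i * cnj (y $ i))"

lemma hinner_self: "hinner x x = complex_of_real ((norm x)\<^sup>2)"
  by (simp add: hinner_def norm_vec_def L2_set_def sum_nonneg
      complex_norm_square del: of_real_power)

text \<open>The matrix \<open>x y\<^sup>*\<close>.\<close>

definition outer :: "complex ^ 'm \<Rightarrow> complex ^ 'm \<Rightarrow> complex ^ 'm ^ 'm" where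
  "outer x y = (\<chi> a b. x $ a * cnj (y $ b))"

text \<open>
  A family of \<open>N\<close> vectors is a function on a finite index type \<open>'n\<close> with \<open>CARD('n) = N\<close>; repeated
  vectors are allowed.  The span is the complex one, taken with respect to \<open>*s\<close>.
\<close>

definition is_frame :: "('n::finite \<Rightarrow> complex ^ 'm) \<Rightarrow> bool" where
  "is_frame \<Phi> \<longleftrightarrow> vec.span (range \<Phi>) = UNIV"

definition tight :: "('n::finite \<Rightarrow> complex ^ 'm) \<Rightarrow> bool" where
  "tight \<Phi> \<longleftrightarrow> (\<exists>A::real. A > 0 \<and> (\<Sum>j\<in>UNIV. outer (\<Phi> j) (\<Phi> j)) = A *\<^sub>R mat 1)"

definition unit_norm_frames :: "('n::finite \<Rightarrow> complex ^ 'm) set" where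
  "unit_norm_frames = {\<Phi>. is_frame \<Phi> \<and> (\<forall>j. norm (\<Phi> j) = 1)}"

definition angle_set :: "('n::finite \<Rightarrow> complex ^ 'm) \<Rightarrow> real set" where
  "angle_set \<Phi> = {cmod (hinner (\<Phi> j) (\<Phi> l)) | j l. j \<noteq> l}"

definition coherence :: "('n::finite \<Rightarrow> complex ^ 'm) \<Rightarrow> real" where
  "coherence \<Phi> = Max (angle_set \<Phi>)"

text \<open>
  The argument only carries the types \<open>'n\<close> and \<open>'m\<close>, that is \<open>N\<close> and \<open>M\<close>.
\<close>

definition grassmannian_constant :: "('n::finite \<Rightarrow> complex ^ 'm) itself \<Rightarrow> real" where
  "grassmannian_constant _ =
     (INF \<Psi> \<in> (unit_norm_frames :: ('n \<Rightarrow> complex ^ 'm) set). coherence \<Psi>)"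

definition grassmannian_frame :: "('n::finite \<Rightarrow> complex ^ 'm) \<Rightarrow> bool" where
  "grassmannian_frame \<Phi> \<longleftrightarrow>
     \<Phi> \<in> unit_norm_frames \<and>
     coherence \<Phi> = grassmannian_constant TYPE('n \<Rightarrow> complex ^ 'm)"

end

theory Submission
  imports Defs
begin

text \<open>
  Send a vector of \<open>\<complex>\<^sup>2\<close> to its Bloch vector in \<open>\<real>\<^sup>3\<close> (the traceless part of \<open>\<phi>\<phi>\<^sup>*\<close>).  Unit vectors go
  to the unit sphere, \<open>2 \<bar>\<langle>\<phi>,\<psi>\<rangle>\<bar>\<^sup>2 - 1\<close> becomes the real inner product (\<open>inner_bloch\<close>), and tightness
  says that the Bloch vectors add up to zero (\<open>tight_imp_sum_bloch_eq_0\<close>).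

  Five of the six vertices of an octahedron form a frame with coherence \<open>1/\<surd>2\<close>, so the Bloch vectors of
  a Grassmannian frame are pairwise at an angle of at least \<open>\<pi>/2\<close>
  (\<open>grassmannian_frame_5_2_inner_bloch\<close>).  Five such vectors in \<open>\<real>\<^sup>3\<close> are so dependent that, having
  sum zero, they split into two orthogonal parts, each with sum zero (\<open>obtuse_family_splits\<close>).
  A part of unit vectors with sum zero has at least two members, so the parts have sizes two and three:
  an antipodal pair, and an equilateral triangle on the equator orthogonal to it.  The inner products
  are therefore \<open>-1\<close>, \<open>-1/2\<close> and \<open>0\<close>, which are the angles \<open>0\<close>, \<open>1/2\<close> and \<open>1/\<surd>2\<close>.
\<close>

section \<open>Obtuse families with sum zero\<close>

text \<open>
  Leaving out one index still leaves more vectors than the dimension, so there is a linear relation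
  whose coefficients are not all equal.  Since the vectors add up to zero, the least coefficient can be
  subtracted from all of them, and \<open>S\<close> is the support of the resulting nonnegative relation.  Its inner
  product with a vector outside \<open>S\<close> is a vanishing sum of nonpositive terms, so each term vanishes.
\<close>

lemma obtuse_family_splits:
  fixes v :: "'n::finite \<Rightarrow> 'a::euclidean_space"
  assumes card: "CARD('n) \<ge> DIM('a) + 2"
    and nz: "\<And>j. v j \<noteq> 0"
    and obtuse: "\<And>j l. j \<noteq> l \<Longrightarrow> v j \<bullet> v l \<le> 0"
    and sum0: "(\<Sum>j\<in>UNIV. v j) = 0"
  obtains S where "S \<noteq> {}" "S \<noteq> UNIV"
    "\<And>j l. j \<in> S \<Longrightarrow> l \<notin> S \<Longrightarrow> v j \<bullet> v l = 0"
    "(\<Sum>j\<in>S. v j) = 0" "(\<Sum>j\<in>-S. v j) = 0"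
proof -
  have inj: "inj v"
  proof (rule injI, rule ccontr)
    fix j l assume "v j = v l" "j \<noteq> l"
    then have "v j \<bullet> v j \<le> 0" using obtuse by metis
    then show False using nz by (simp flip: not_less)
  qed
  fix k :: 'n
  have "card (v ` (UNIV - {k})) = CARD('n) - 1"
    using inj by (subst card_image) (auto intro: inj_on_subset)
  then have "dependent (v ` (UNIV - {k}))"
    using card by (intro dependent_biggerset) auto
  then obtain w where w: "\<exists>x\<in>v ` (UNIV - {k}). w x \<noteq> 0"
      and w0: "(\<Sum>x\<in>v ` (UNIV - {k}). w x *\<^sub>R x) = 0"
    by (auto simp: dependent_finite)
  define c where "c j = (if j = k then 0 else w (v j))" for j
  have c0: "(\<Sum>j\<in>UNIV. c j *\<^sub>R v j) = 0"
  proof -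
    have "(\<Sum>j\<in>UNIV. c j *\<^sub>R v j) = (\<Sum>j\<in>UNIV - {k}. w (v j) *\<^sub>R v j)"
      by (rule sum.mono_neutral_cong_right) (auto simp: c_def)
    also have "\<dots> = (\<Sum>x\<in>v ` (UNIV - {k}). w x *\<^sub>R x)"
      using inj by (subst sum.reindex) (auto intro: inj_on_subset)
    finally show ?thesis using w0 by simp
  qed
  define m where "m = Min (range c)"
  have m_le: "m \<le> c j" for j
    by (simp add: m_def)
  have "m \<in> range c"
    unfolding m_def by (rule Min_in) auto
  then obtain i where i: "c i = m" by auto
  define S where "S = {j. c j \<noteq> m}"
  have relation: "(\<Sum>j\<in>UNIV. (c j - m) *\<^sub>R v j) = 0"
    using c0 sum0 by (simp add: algebra_simps sum_subtractf flip: scaleR_right.sum)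
  have orth: "v j \<bullet> v l = 0" if "j \<in> S" "l \<notin> S" for j l
  proof -
    have "(\<Sum>j\<in>UNIV. - ((c j - m) * (v j \<bullet> v l))) = - ((\<Sum>j\<in>UNIV. (c j - m) *\<^sub>R v j) \<bullet> v l)"
      by (simp add: inner_sum_left sum_negf)
    then have "(\<Sum>j\<in>UNIV. - ((c j - m) * (v j \<bullet> v l))) = 0"
      using relation by simp
    moreover have "0 \<le> - ((c j - m) * (v j \<bullet> v l))" for j
    proof (cases "j = l")
      case True
      then show ?thesis using \<open>l \<notin> S\<close> by (simp add: S_def)
    next
      case False
      then show ?thesis using m_le[of j] obtuse[of j l] by (simp add: mult_nonneg_nonpos)
    qed
    ultimately have "- ((c j - m) * (v j \<bullet> v l)) = 0"
      by (subst (asm) sum_nonneg_eq_0_iff) auto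
    then show ?thesis using \<open>j \<in> S\<close> by (auto simp: S_def)
  qed
  have sums: "(\<Sum>j\<in>S. v j) + (\<Sum>j\<in>-S. v j) = 0"
    using sum0 sum.union_disjoint[of S "-S" v] by simp
  \<comment> \<open>The two partial sums are orthogonal and opposite.\<close>
  have "(\<Sum>j\<in>S. v j) \<bullet> (\<Sum>j\<in>-S. v j) = 0"
    by (simp add: inner_sum_left inner_sum_right orth sum.neutral)
  then have S0: "(\<Sum>j\<in>S. v j) = 0"
    using sums by (simp add: add_eq_0_iff2)
  have "S \<noteq> {}"
  proof
    \<comment> \<open>The coefficient of \<open>k\<close> is zero, so constant coefficients would all vanish.\<close>
    assume "S = {}"
    then have "c j = c k" for j by (simp add: S_def)
    then have "c j = 0" for j by (simp add: c_def)
    then show False using w unfolding c_def by (metis (no_types, lifting) DiffE imageE insertI1)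
  qed
  moreover have "S \<noteq> UNIV" using i by (auto simp: S_def)
  ultimately show ?thesis using that orth S0 sums by simp
qed

lemma sum_unit_vectors_eq_0_imp_two_le_card:
  fixes v :: "'n \<Rightarrow> 'a::real_normed_vector"
  assumes "finite S" "S \<noteq> {}" "\<And>j. norm (v j) = 1" "(\<Sum>j\<in>S. v j) = 0"
  shows "2 \<le> card S"
proof (rule ccontr)
  assume "\<not> 2 \<le> card S"
  moreover have "card S \<noteq> 0" using assms by simp
  ultimately have "card S = 1" by linarith
  then obtain a where "S = {a}" by (rule card_1_singletonE)
  then have "v a = 0" using assms(4) by simp
  then show False using assms(3)[of a] by simp
qed

text \<open>
  Each part of the splitting has at least two members, so one part is a pair of opposite vectors and the
  other consists of three unit vectors with sum zero, two of which enclose an angle of \<open>2\<pi>/3\<close> because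
  their sum is again a unit vector.
\<close>

lemma five_unit_vectors_inner_products:
  fixes v :: "5 \<Rightarrow> real ^ 3"
  assumes unit: "\<And>j. norm (v j) = 1"
    and obtuse: "\<And>j l. j \<noteq> l \<Longrightarrow> v j \<bullet> v l \<le> 0"
    and sum0: "(\<Sum>j\<in>UNIV. v j) = 0"
  shows "{-1, -1/2, 0} \<subseteq> {v j \<bullet> v l | j l. j \<noteq> l}"
proof -
  have self: "v j \<bullet> v j = 1" for j
    using unit[of j] by (simp add: dot_square_norm)
  have nz: "v j \<noteq> 0" for j using unit[of j] by auto
  obtain S where S: "S \<noteq> {}" "S \<noteq> UNIV" "\<And>j l. j \<in> S \<Longrightarrow> l \<notin> S \<Longrightarrow> v j \<bullet> v l = 0"
      and S0: "(\<Sum>j\<in>S. v j) = 0" "(\<Sum>j\<in>-S. v j) = 0"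
    by (rule obtuse_family_splits[OF _ nz obtuse sum0]) auto
  have ge: "2 \<le> card S" "2 \<le> card (-S)"
    using S S0 unit by (auto intro!: sum_unit_vectors_eq_0_imp_two_le_card[of _ v])
  have "card S + card (-S) = 5"
    using card_Un_disjoint[of S "-S"] by simp
  then have "card S = 2 \<and> card (-S) = 3 \<or> card (-S) = 2 \<and> card (-(-S)) = 3"
    using ge by auto
  then obtain T where T: "card T = 2" "card (-T) = 3"
      and T0: "(\<Sum>j\<in>T. v j) = 0" "(\<Sum>j\<in>-T. v j) = 0"
      and orth: "\<And>j l. j \<in> T \<Longrightarrow> l \<notin> T \<Longrightarrow> v j \<bullet> v l = 0"
    using S S0 by (metis (no_types, lifting) ComplI Compl_iff double_complement inner_commute)
  obtain a b where ab: "T = {a, b}" "a \<noteq> b"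
    using T(1) by (auto simp: card_2_iff)
  obtain p q r where pqr: "-T = {p, q, r}" "p \<noteq> q" "q \<noteq> r" "p \<noteq> r"
    using T(2) by (auto simp: card_3_iff)
  have "v a = - v b"
    using T0(1) ab by (simp add: add_eq_0_iff2)
  then have "v a \<bullet> v b = -1" by (simp add: self)
  moreover have "v p \<bullet> v q = -1/2"
  proof -
    have "v p + v q = - v r"
      using T0(2) pqr by (simp add: add_eq_0_iff2 flip: add.assoc)
    then have "(v p + v q) \<bullet> (v p + v q) = v r \<bullet> v r" by simp
    then show ?thesis by (simp add: inner_add inner_commute self)
  qed
  moreover have "a \<in> T" "p \<notin> T" using ab pqr by auto
  then have "v a \<bullet> v p = 0" "a \<noteq> p" using orth by auto
  ultimately show ?thesis
    using ab(2) pqr(2) by (auto; metis)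
qed

section \<open>Bloch vectors\<close>

text \<open>
  The coordinates of \<open>2 x x\<^sup>* - \<parallel>x\<parallel>\<^sup>2 I\<close> in the basis of Pauli matrices, up to the sign of the second one.
\<close>

definition bloch :: "complex ^ 2 \<Rightarrow> real ^ 3" where
  "bloch x = vector [2 * Re (x $ 1 * cnj (x $ 2)), 2 * Im (x $ 1 * cnj (x $ 2)),
                     (cmod (x $ 1))\<^sup>2 - (cmod (x $ 2))\<^sup>2]"

lemma norm_vec2_squared: "(norm (x :: complex ^ 2))\<^sup>2 = (cmod (x $ 1))\<^sup>2 + (cmod (x $ 2))\<^sup>2"
  by (simp add: norm_vec_def L2_set_def sum_2)

lemma inner_bloch:
  "bloch x \<bullet> bloch y = 2 * (cmod (hinner x y))\<^sup>2 - (norm x)\<^sup>2 * (norm y)\<^sup>2"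
  unfolding norm_vec2_squared
  by (simp add: bloch_def inner_vec_def sum_3 hinner_def sum_2 cmod_power2) algebra

lemma inner_bloch_unit:
  assumes "norm x = 1" "norm y = 1"
  shows "bloch x \<bullet> bloch y = 2 * (cmod (hinner x y))\<^sup>2 - 1"
  by (simp add: inner_bloch assms)

lemma norm_bloch_unit:
  assumes "norm x = 1"
  shows "norm (bloch x) = 1"
  using inner_bloch_unit[OF assms assms] by (simp add: hinner_self assms norm_eq_1)

text \<open>
  The components of the sum of the Bloch vectors are twice the real and imaginary part of an
  off-diagonal entry of the frame operator, and the difference of its two diagonal entries.
\<close>

lemma tight_imp_sum_bloch_eq_0:
  fixes \<Phi> :: "'n::finite \<Rightarrow> complex ^ 2"
  assumes "tight \<Phi>"
  shows "(\<Sum>j\<in>UNIV. bloch (\<Phi> j)) = 0"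
proof -
  obtain A :: real where A: "(\<Sum>j\<in>UNIV. outer (\<Phi> j) (\<Phi> j)) = A *\<^sub>R mat 1"
    using assms by (auto simp: tight_def)
  have entry: "(\<Sum>j\<in>UNIV. \<Phi> j $ a * cnj (\<Phi> j $ b)) = (if a = b then of_real A else 0)" for a b
  proof -
    have "(\<Sum>j\<in>UNIV. outer (\<Phi> j) (\<Phi> j)) $ a $ b = (A *\<^sub>R mat 1) $ a $ b"
      by (simp only: A)
    then show ?thesis
      by (simp add: outer_def mat_def sum_component) (simp add: scaleR_conv_of_real)
  qed
  have diag: "(\<Sum>j\<in>UNIV. (cmod (\<Phi> j $ a))\<^sup>2) = A" for a
  proof -
    have "complex_of_real (\<Sum>j\<in>UNIV. (cmod (\<Phi> j $ a))\<^sup>2) = of_real A"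
      using entry[of a a] by (simp add: complex_norm_square del: of_real_power)
    then show ?thesis by (simp only: of_real_eq_iff)
  qed
  have offdiag: "(\<Sum>j\<in>UNIV. Re (\<Phi> j $ 1 * cnj (\<Phi> j $ 2))) = 0"
      "(\<Sum>j\<in>UNIV. Im (\<Phi> j $ 1 * cnj (\<Phi> j $ 2))) = 0"
    using entry[of 1 2] by (simp_all only: flip: Re_sum Im_sum) simp_all
  show ?thesis
    using offdiag diag
    by (simp add: vec_eq_iff forall_3 bloch_def sum_component sum_subtractf
        del: times_complex.simps flip: sum_distrib_left)
qed

section \<open>The coherence of a Grassmannian frame of five vectors in the plane\<close>

lemma finite_angle_set: "finite (angle_set \<Phi>)"
proof -
  have "angle_set \<Phi> \<subseteq> (\<lambda>(j, l). cmod (hinner (\<Phi> j) (\<Phi> l))) ` UNIV"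
    by (auto simp: angle_set_def)
  then show ?thesis by (rule finite_subset) simp
qed

lemma angle_le_coherence: "j \<noteq> l \<Longrightarrow> cmod (hinner (\<Phi> j) (\<Phi> l)) \<le> coherence \<Phi>"
  unfolding coherence_def by (rule Max_ge[OF finite_angle_set]) (auto simp: angle_set_def)

lemma angle_set_nonempty:
  fixes \<Phi> :: "'n::finite \<Rightarrow> complex ^ 'm"
  assumes "CARD('n) \<ge> 2"
  shows "angle_set \<Phi> \<noteq> {}"
proof -
  obtain j l :: 'n where "j \<noteq> l"
    using assms by (metis UNIV_I card_2_iff' obtain_subset_with_card_n)
  then show ?thesis by (auto simp: angle_set_def)
qed

lemma grassmannian_constant_le_coherence:
  fixes \<Psi> :: "'n::finite \<Rightarrow> complex ^ 'm"
  assumes card: "CARD('n) \<ge> 2" and "\<Psi> \<in> unit_norm_frames"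
  shows "grassmannian_constant TYPE('n \<Rightarrow> complex ^ 'm) \<le> coherence \<Psi>"
proof -
  have "0 \<le> coherence \<Phi>" for \<Phi> :: "'n \<Rightarrow> complex ^ 'm"
    using Max_in[OF finite_angle_set angle_set_nonempty[OF card, of \<Phi>]]
    by (auto simp: coherence_def angle_set_def)
  then have "bdd_below (coherence ` (unit_norm_frames :: ('n \<Rightarrow> complex ^ 'm) set))"
    by (auto intro!: bdd_belowI[of _ 0])
  then show ?thesis
    unfolding grassmannian_constant_def using assms(2) by (rule cINF_lower)
qed

text \<open>
  The Bloch vectors are \<open>\<plusminus>e\<^sub>3\<close>, \<open>\<plusminus>e\<^sub>1\<close> and \<open>-e\<^sub>2\<close>, for the standard basis \<open>e\<^sub>1, e\<^sub>2, e\<^sub>3\<close> of \<open>\<real>\<^sup>3\<close>.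
\<close>

definition octahedral_vectors :: "(complex ^ 2) list" where
  "octahedral_vectors =
     [vector [1, 0], vector [0, 1],
      vector [1 / sqrt 2, 1 / sqrt 2], vector [1 / sqrt 2, - 1 / sqrt 2],
      vector [1 / sqrt 2, \<i> / sqrt 2]]"

lemma norm_octahedral_vectors: "k < 5 \<Longrightarrow> norm (octahedral_vectors ! k) = 1"
  by (auto simp: octahedral_vectors_def less_Suc_eq numeral_eq_Suc norm_vec_def L2_set_def sum_2
      norm_divide power_divide)

lemma hinner_octahedral_vectors:
  "k < 5 \<Longrightarrow> l < 5 \<Longrightarrow> k \<noteq> l \<Longrightarrow>
     (cmod (hinner (octahedral_vectors ! k) (octahedral_vectors ! l)))\<^sup>2 \<le> 1 / 2"
  by (auto simp: octahedral_vectors_def less_Suc_eq numeral_eq_Suc hinner_def sum_2 norm_divide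
      power_divide cmod_power2[of "_ + _"] cmod_power2[of "_ - _"] simp flip: of_real_mult)
    (simp_all add: cmod_def power2_eq_square)

lemma exists_five_frame_coherence_le:
  obtains \<Psi> :: "5 \<Rightarrow> complex ^ 2"
  where "\<Psi> \<in> unit_norm_frames" "(coherence \<Psi>)\<^sup>2 \<le> 1 / 2"
proof -
  obtain f :: "5 \<Rightarrow> nat" where f: "bij_betw f UNIV {0..<5}"
    using ex_bij_betw_finite_nat[of "UNIV :: 5 set"] by auto
  define \<Psi> where "\<Psi> j = octahedral_vectors ! f j" for j
  have f5: "f j < 5" for j using f by (auto simp: bij_betw_def)
  have range: "octahedral_vectors ! k \<in> range \<Psi>" if "k < 5" for k
    using f that unfolding \<Psi>_def bij_betw_def by (metis atLeastLessThan_iff imageE le0 rangeI)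
  have "x \<in> vec.span (range \<Psi>)" for x
  proof -
    have e: "vector [1, 0] \<in> range \<Psi>" "vector [0, 1] \<in> range \<Psi>"
      using range[of 0] range[of 1] by (simp_all add: octahedral_vectors_def)
    have "x = x $ 1 *s vector [1, 0] + x $ 2 *s vector [0, 1]"
      by (simp add: vec_eq_iff forall_2)
    then show ?thesis
      using e by (metis vec.span_add vec.span_base vec.span_scale)
  qed
  then have "\<Psi> \<in> unit_norm_frames"
    using norm_octahedral_vectors f5 by (auto simp: unit_norm_frames_def is_frame_def \<Psi>_def)
  moreover have "(coherence \<Psi>)\<^sup>2 \<le> 1 / 2"
  proof -
    have "coherence \<Psi> \<in> angle_set \<Psi>"
      unfolding coherence_def by (intro Max_in finite_angle_set angle_set_nonempty) simp
    then obtain j l where "j \<noteq> l" "coherence \<Psi> = cmod (hinner (\<Psi> j) (\<Psi> l))"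
      by (auto simp: angle_set_def)
    moreover have "f j \<noteq> f l" using f \<open>j \<noteq> l\<close> by (auto simp: bij_betw_def inj_on_def)
    ultimately show ?thesis using hinner_octahedral_vectors f5 by (simp add: \<Psi>_def)
  qed
  ultimately show ?thesis by (rule that)
qed

lemma grassmannian_frame_5_2_inner_bloch:
  fixes \<Phi> :: "5 \<Rightarrow> complex ^ 2"
  assumes "grassmannian_frame \<Phi>" "j \<noteq> l"
  shows "bloch (\<Phi> j) \<bullet> bloch (\<Phi> l) \<le> 0"
proof -
  obtain \<Psi> :: "5 \<Rightarrow> complex ^ 2" where \<Psi>: "\<Psi> \<in> unit_norm_frames" "(coherence \<Psi>)\<^sup>2 \<le> 1 / 2"
    by (rule exists_five_frame_coherence_le)
  have "cmod (hinner (\<Phi> j) (\<Phi> l)) \<le> coherence \<Phi>"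
    using assms(2) by (rule angle_le_coherence)
  also have "\<dots> \<le> coherence \<Psi>"
    using assms(1) grassmannian_constant_le_coherence[OF _ \<Psi>(1)]
    by (simp add: grassmannian_frame_def)
  finally have "(cmod (hinner (\<Phi> j) (\<Phi> l)))\<^sup>2 \<le> (coherence \<Psi>)\<^sup>2"
    by (rule power_mono) simp
  then have "(cmod (hinner (\<Phi> j) (\<Phi> l)))\<^sup>2 \<le> 1 / 2" using \<Psi>(2) by linarith
  then show ?thesis
    using assms(1) by (simp add: inner_bloch_unit grassmannian_frame_def unit_norm_frames_def)
qed

section \<open>Tight Grassmannian frames of five vectors in the plane\<close>

theorem theorem5p4:
  fixes \<Phi> :: "5 \<Rightarrow> complex ^ 2"
  assumes "tight \<Phi>"
    and "grassmannian_frame \<Phi>"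
  shows "card (angle_set \<Phi>) \<ge> 3"
proof -
  have unit: "norm (\<Phi> j) = 1" for j
    using assms(2) by (simp add: grassmannian_frame_def unit_norm_frames_def)
  have "{-1, -1/2, 0} \<subseteq> {bloch (\<Phi> j) \<bullet> bloch (\<Phi> l) | j l. j \<noteq> l}"
    using norm_bloch_unit[OF unit] grassmannian_frame_5_2_inner_bloch[OF assms(2)]
      tight_imp_sum_bloch_eq_0[OF assms(1)]
    by (rule five_unit_vectors_inner_products)
  \<comment> \<open>The inner products are images of the angles, so they cannot outnumber them.\<close>
  also have "\<dots> = (\<lambda>t. 2 * t\<^sup>2 - 1) ` angle_set \<Phi>"
    by (auto simp: angle_set_def inner_bloch_unit[OF unit unit])
  finally have "card {-1, -1/2, 0 :: real} \<le> card ((\<lambda>t. 2 * t\<^sup>2 - 1) ` angle_set \<Phi>)"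
    by (intro card_mono) (simp_all add: finite_angle_set)
  also have "\<dots> \<le> card (angle_set \<Phi>)"
    by (rule card_image_le[OF finite_angle_set])
  finally show ?thesis by simp
qed

end
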